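(* Let $q\ge0$ and let $X$ be a spectrally negative Lévy process with triplet $(\gamma,\sigma,\Pi)$ such that $\sigma>0$ and $\Pi(0,\infty)<\infty$. Assume that the $q$-scale function $W^{(q)}$ of $X$ is three times continuously differentiable on $(0,\infty)$. Then $$(\mathcal G-q)W^{(q)\prime}_+(x)=0\quad\text{for all }x>0,$$ where $W^{(q)\prime}_+:\mathbb R\to\mathbb R$ denotes the right derivative of $W^{(q)}$.
   Context: $X$ is a spectrally negative Lévy process with triplet $(\gamma,\sigma,\Pi)$: $\gamma\in\mathbb R$, $\sigma\ge0$, $\Pi$ a measure concentrated on $(0,\infty)$ with $\int_0^\infty(1\wedge x^2)\Pi(dx)<\infty$, and Laplace exponent ($\mathbb E_x[e^{\theta X_t}]=e^{\theta x+\psi_X(\theta)t}$, $t,\theta\ge0$) $$\psi_X(\theta)=\gamma\theta+\tfrac12\sigma^2\theta^2-\int_{(0,\infty)}(1-e^{-\theta z}-\theta z1_{\{0<z<1\}})\Pi(dz).$$ With $\Phi(q)=\sup\{\theta\ge0:\psi_X(\theta)=q\}$, the $q$-scale function $W^{(q)}:\mathbb R\to[0,\infty)$ vanishes on $(-\infty,0)$ and on $[0,\infty)$ is the strictly increasing continuous function with $\int_0^\infty e^{-\theta x}W^{(q)}(x)dx=\frac1{\psi_X(\theta)-q}$ for $\theta>\Phi(q)$. For $\omega:\mathbb R\to\mathbb R$ twice continuously differentiable on $(0,\infty)$, the generator acts, for $x>0$, by $$\mathcal G\omega(x)=\gamma\omega'(x)+\frac{\sigma^2}{2}\omega''(x)+\int_{(0,\infty)}\left[\omega(x-y)-\omega(x)+\omega'(x)y1_{\{0<y<1\}}\right]\Pi(dy).$$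 *)

theory Defs
  imports "HOL-Probability.Probability"
begin

definition levy_triplet :: "real \<Rightarrow> real \<Rightarrow> real measure \<Rightarrow> bool" where
  "levy_triplet \<gamma> \<sigma> \<nu> \<longleftrightarrow>
     0 \<le> \<sigma> \<and> sets \<nu> = sets borel \<and> emeasure \<nu> {..0} = 0 \<and>
     (\<integral>\<^sup>+ x. ennreal (min 1 (x\<^sup>2)) \<partial>\<nu>) < \<infinity>"

text \<open>The jumps are \<^emph>\<open>minus\<close> the points of \<open>\<nu>\<close>, so \<open>\<nu>\<close> lives on the positive half-line.\<close>

definition laplace_exponent :: "real \<Rightarrow> real \<Rightarrow> real measure \<Rightarrow> real \<Rightarrow> real" where
  "laplace_exponent \<gamma> \<sigma> \<nu> \<theta> =
     \<gamma> * \<theta> + \<sigma>\<^sup>2 * \<theta>\<^sup>2 / 2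
     - (LINT z:{0<..}|\<nu>. 1 - exp (- \<theta> * z) - \<theta> * z * indicator {0<..<1} z)"

definition levy_process_from :: "real \<Rightarrow> 'a measure \<Rightarrow> (real \<Rightarrow> 'a \<Rightarrow> real) \<Rightarrow> bool" where
  "levy_process_from x M X \<longleftrightarrow>
     prob_space M \<and>
     (\<forall>t\<ge>0. X t \<in> borel_measurable M) \<and>
     (AE \<omega> in M. X 0 \<omega> = x) \<and>
     (\<forall>(n::nat) (t::nat \<Rightarrow> real). 0 \<le> t 0 \<longrightarrow> (\<forall>i<n. t i \<le> t (Suc i)) \<longrightarrow>
        prob_space.indep_vars M (\<lambda>_. borel) (\<lambda>i \<omega>. X (t (Suc i)) \<omega> - X (t i) \<omega>) {..<n}) \<and>
     (\<forall>s\<ge>0. \<forall>h\<ge>0.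
        distr M borel (\<lambda>\<omega>. X (s + h) \<omega> - X s \<omega>) = distr M borel (\<lambda>\<omega>. X h \<omega> - X 0 \<omega>)) \<and>
     (AE \<omega> in M.
        (\<forall>t\<ge>0. continuous (at_right t) (\<lambda>s. X s \<omega>)) \<and>
        (\<forall>t>0. \<exists>l. ((\<lambda>s. X s \<omega>) \<longlongrightarrow> l) (at_left t)))"

definition no_positive_jumps :: "'a measure \<Rightarrow> (real \<Rightarrow> 'a \<Rightarrow> real) \<Rightarrow> bool" where
  "no_positive_jumps M X \<longleftrightarrow>
     (AE \<omega> in M. \<forall>t>0. \<forall>l. ((\<lambda>s. X s \<omega>) \<longlongrightarrow> l) (at_left t) \<longrightarrow> X t \<omega> \<le> l)"

text \<open>\<open>P x\<close> is the law under which the process starts from \<open>x\<close>. Since \<open>X\<close> has no positive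
  jumps, its exponential moments exist and the Laplace exponent identifies the triplet.\<close>

definition spectrally_negative_levy ::
  "(real \<Rightarrow> 'a measure) \<Rightarrow> (real \<Rightarrow> 'a \<Rightarrow> real) \<Rightarrow> real \<Rightarrow> real \<Rightarrow> real measure \<Rightarrow> bool" where
  "spectrally_negative_levy P X \<gamma> \<sigma> \<nu> \<longleftrightarrow>
     levy_triplet \<gamma> \<sigma> \<nu> \<and>
     (\<forall>x. sets (P x) = sets (P 0) \<and> levy_process_from x (P x) X \<and> no_positive_jumps (P x) X \<and>
       (\<forall>t\<ge>0. \<forall>\<theta>\<ge>0. has_bochner_integral (P x) (\<lambda>\<omega>. exp (\<theta> * X t \<omega>))
          (exp (\<theta> * x + laplace_exponent \<gamma> \<sigma> \<nu> \<theta> * t))))"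

text \<open>For \<open>\<sigma> > 0\<close> the supremum below is over a nonempty bounded set, because the Laplace
  exponent is continuous and strictly convex, vanishes at 0 and tends to infinity.\<close>

definition right_inverse_exponent :: "real \<Rightarrow> real \<Rightarrow> real measure \<Rightarrow> real \<Rightarrow> real" where
  "right_inverse_exponent \<gamma> \<sigma> \<nu> q = Sup {\<theta>. 0 \<le> \<theta> \<and> laplace_exponent \<gamma> \<sigma> \<nu> \<theta> = q}"

text \<open>The conditions determine \<open>W\<close> uniquely, by injectivity of the Laplace transform on
  continuous functions.\<close>

definition is_scale_function ::
  "real \<Rightarrow> real \<Rightarrow> real measure \<Rightarrow> real \<Rightarrow> (real \<Rightarrow> real) \<Rightarrow> bool" where
  "is_scale_function \<gamma> \<sigma> \<nu> q W \<longleftrightarrow>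
     (\<forall>x. 0 \<le> W x) \<and> (\<forall>x<0. W x = 0) \<and>
     strict_mono_on {0..} W \<and> continuous_on {0..} W \<and>
     (\<forall>\<theta> > right_inverse_exponent \<gamma> \<sigma> \<nu> q.
        set_integrable lborel {0..} (\<lambda>x. exp (- \<theta> * x) * W x) \<and>
        (LBINT x:{0..}. exp (- \<theta> * x) * W x) = 1 / (laplace_exponent \<gamma> \<sigma> \<nu> \<theta> - q))"

definition C_k_on :: "nat \<Rightarrow> (real \<Rightarrow> real) \<Rightarrow> real set \<Rightarrow> bool" where
  "C_k_on k f S \<longleftrightarrow>
     (\<forall>j<k. \<forall>x\<in>S. (deriv ^^ j) f field_differentiable at x) \<and>
     continuous_on S ((deriv ^^ k) f)"

definition right_deriv :: "(real \<Rightarrow> real) \<Rightarrow> real \<Rightarrow> real" where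
  "right_deriv f x = vector_derivative f (at_right x)"

definition generator_integrand :: "(real \<Rightarrow> real) \<Rightarrow> real \<Rightarrow> real \<Rightarrow> real" where
  "generator_integrand \<omega> x y =
     \<omega> (x - y) - \<omega> x + deriv \<omega> x * y * indicator {0<..<1} y"

definition generator ::
  "real \<Rightarrow> real \<Rightarrow> real measure \<Rightarrow> (real \<Rightarrow> real) \<Rightarrow> real \<Rightarrow> real" where
  "generator \<gamma> \<sigma> \<nu> \<omega> x =
     \<gamma> * deriv \<omega> x + \<sigma>\<^sup>2 / 2 * deriv (deriv \<omega>) x
     + (LINT y:{0<..}|\<nu>. generator_integrand \<omega> x y)"

end

theory Submission
  imports Defs "HOL-Real_Asymp.Real_Asymp"
begin

text \<open>Write \<open>\<lambda>\<close> for the total mass of \<open>\<nu>\<close>, \<open>c = \<gamma> + \<integral> y 1{0 < y < 1} \<nu>(dy)\<close> and \<open>I f (x)\<close> for the integral of \<open>f\<close>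
  over \<open>[0, x]\<close>. Since \<open>\<nu>\<close> is finite, the Laplace exponent is \<open>c \<theta> + \<sigma>\<^sup>2 \<theta>\<^sup>2 / 2 - \<lambda>\<close> plus the
  Laplace transform of \<open>\<nu>\<close>. Dividing the identity that defines \<open>W\<close> by \<open>\<theta>\<^sup>2\<close> and inverting the transform
  gives \<open>\<sigma>\<^sup>2/2 W + c I W + I (I (W * \<nu> - (\<lambda> + q) W)) = x\<close> on \<open>[0, \<infinity>)\<close>. Hence \<open>W(0) = 0\<close>, \<open>W\<close> is
  \<open>C\<^sup>1\<close> up to the boundary (so the right derivative at 0, which matters when \<open>\<nu>\<close> has atoms, exists), and
  \<open>\<sigma>\<^sup>2/2 W'' + c W' + W * \<nu> = (\<lambda> + q) W\<close> on \<open>(0, \<infinity>)\<close>. Differentiating once more is the claim,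
  because \<open>W\<close> is locally Lipschitz and dominated convergence yields \<open>(W * \<nu>)' = W'\<^sub>+ * \<nu>\<close>.\<close>

section \<open>Laplace transforms on the half-line\<close>

text \<open>Tonelli's theorem and translation invariance of Lebesgue measure: shifting
  \<open>x\<close> by \<open>y\<close> pulls out the factor \<open>exp (- \<theta> * y)\<close>.
  Nonnegativity of \<open>f\<close> lets the computation run in the extended nonnegative
  reals.\<close>

lemma laplace_transform_convolution:
  fixes f :: "real \<Rightarrow> real"
  assumes sf: "sigma_finite_measure \<mu>" and sets [measurable_cong]: "sets \<mu> = sets borel"
    and meas [measurable]: "f \<in> borel_measurable borel" and nonneg: "\<And>x. 0 \<le> f x"
    and int: "\<And>x. integrable \<mu> (\<lambda>y. f (x - y))"
    and L: "has_bochner_integral lborel (\<lambda>x. exp (- \<theta> * x) * f x) l"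
    and M: "has_bochner_integral \<mu> (\<lambda>y. exp (- \<theta> * y)) m"
  shows "has_bochner_integral lborel (\<lambda>x. exp (- \<theta> * x) * (LINT y|\<mu>. f (x - y))) (l * m)"
proof -
  interpret sigma_finite_measure \<mu> by (rule sf)
  interpret pair_sigma_finite \<mu> lborel ..
  have l: "0 \<le> l" and m: "0 \<le> m"
    using L M nonneg by (auto simp: has_bochner_integral_iff intro!: integral_nonneg)
  have Ln: "(\<integral>\<^sup>+x. ennreal (exp (- \<theta> * x) * f x) \<partial>lborel) = ennreal l"
    using L nonneg by (subst nn_integral_eq_integral) (auto simp: has_bochner_integral_iff)
  have Mn: "(\<integral>\<^sup>+y. ennreal (exp (- \<theta> * y)) \<partial>\<mu>) = ennreal m"
    using M by (subst nn_integral_eq_integral) (auto simp: has_bochner_integral_iff)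
  have shift: "(\<integral>\<^sup>+x. ennreal (exp (- \<theta> * x) * f (x - y)) \<partial>lborel) = ennreal (exp (- \<theta> * y)) * ennreal l"
    for y
  proof -
    have "(\<integral>\<^sup>+x. ennreal (exp (- \<theta> * x) * f (x - y)) \<partial>lborel)
        = (\<integral>\<^sup>+x. ennreal (exp (- \<theta> * (y + 1 * x)) * f (y + 1 * x - y)) \<partial>lborel)"
      by (subst nn_integral_real_affine[where c = 1 and t = y]) auto
    also have "\<dots> = (\<integral>\<^sup>+x. ennreal (exp (- \<theta> * y)) * ennreal (exp (- \<theta> * x) * f x) \<partial>lborel)"
      by (intro nn_integral_cong)
        (simp add: ennreal_mult'[symmetric] nonneg exp_diff exp_minus field_simps flip: exp_add)
    finally show ?thesis by (simp add: nn_integral_cmult Ln[simplified])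
  qed
  have "(\<integral>\<^sup>+x. ennreal (exp (- \<theta> * x) * (LINT y|\<mu>. f (x - y))) \<partial>lborel)
      = (\<integral>\<^sup>+x. (\<integral>\<^sup>+y. ennreal (exp (- \<theta> * x) * f (x - y)) \<partial>\<mu>) \<partial>lborel)"
    using int nonneg
    by (intro nn_integral_cong, subst nn_integral_eq_integral) auto
  also have "\<dots> = (\<integral>\<^sup>+y. (\<integral>\<^sup>+x. ennreal (exp (- \<theta> * x) * f (x - y)) \<partial>lborel) \<partial>\<mu>)"
    by (rule Fubini') measurable
  also have "\<dots> = ennreal (l * m)"
    unfolding shift using l m Mn
    by (subst nn_integral_multc) (auto simp: ennreal_mult' mult.commute)
  finally show ?thesis
    using l m nonneg
    by (intro has_bochner_integral_nn_integral) (auto intro!: integral_nonneg AE_I2)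
qed

lemma laplace_transform_Heaviside:
  assumes "0 < \<theta>"
  shows "has_bochner_integral lborel (\<lambda>x::real. exp (- \<theta> * x) * indicator {0..} x) (1 / \<theta>)"
proof (rule has_bochner_integral_nn_integral)
  have "((\<lambda>x. exp (- \<theta> * x) * indicator {0..} x) has_integral 1 / \<theta>) UNIV"
    using has_integral_exp_minus_to_infinity[OF assms, of 0]
    by (subst (asm) has_integral_restrict_UNIV[symmetric])
       (auto elim!: has_integral_eq[rotated] simp: indicator_def)
  then show "(\<integral>\<^sup>+x. ennreal (exp (- \<theta> * x) * indicator {0..} x) \<partial>lborel) = ennreal (1 / \<theta>)"
    by (intro nn_integral_has_integral_lborel) auto
qed (use assms in auto)

text \<open>The primitive of \<open>f\<close> is the convolution of the Heaviside function with the measure of density \<open>f\<close>.\<close>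

lemma laplace_transform_primitive:
  fixes f :: "real \<Rightarrow> real"
  assumes nonneg: "\<And>x. 0 \<le> f x" and neg: "\<And>x. x < 0 \<Longrightarrow> f x = 0"
    and \<theta>: "0 < \<theta>" and L: "has_bochner_integral lborel (\<lambda>x. exp (- \<theta> * x) * f x) l"
  shows "f integrable_on {0..x}"
    and "has_bochner_integral lborel (\<lambda>x. exp (- \<theta> * x) * integral {0..x} f) (l / \<theta>)"
proof -
  have "(\<lambda>x. exp (\<theta> * x) * (exp (- \<theta> * x) * f x)) \<in> borel_measurable lborel"
    by (intro borel_measurable_times borel_measurable_has_bochner_integral[OF L]) auto
  then have meas [measurable]: "f \<in> borel_measurable borel"
    by (simp add: mult.assoc[symmetric] flip: exp_add)
  let ?\<mu> = "density lborel (\<lambda>x. ennreal (f x))"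
  \<comment> \<open>Where \<open>y \<le> x\<close> the factor
    \<open>exp (\<theta> * (x - y))\<close> is at least 1, so convergence of the Laplace integral at
    a single positive \<theta> yields local integrability.\<close>
  have int: "integrable lborel (\<lambda>y. f y * indicator {0..} (x - y))" for x
  proof (rule Bochner_Integration.integrable_bound)
    show "integrable lborel (\<lambda>y. exp (\<theta> * x) * (exp (- \<theta> * y) * f y))"
      using L by (intro integrable_mult_right) (auto simp: has_bochner_integral_iff)
    have "f y * indicator {0..} (x - y) \<le> exp (\<theta> * x) * (exp (- \<theta> * y) * f y)" for y
    proof -
      have "indicator {0..} (x - y) \<le> exp (\<theta> * (x - y))"
        using \<theta> by (auto simp: indicator_def)
      then have "f y * indicator {0..} (x - y) \<le> f y * exp (\<theta> * (x - y))"
        by (intro mult_left_mono nonneg)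
      then show ?thesis by (simp add: exp_diff exp_minus field_simps)
    qed
    then show "AE y in lborel. norm (f y * indicator {0..} (x - y))
        \<le> norm (exp (\<theta> * x) * (exp (- \<theta> * y) * f y))"
      using nonneg by (auto simp: abs_mult)
  qed measurable
  have eq: "f y * indicator {0..} (x - y) = indicator {0..x} y * f y" for x y
    using neg[of y] by (auto simp: indicator_def)
  have si: "set_integrable lborel {0..x} f" for x
    using int[of x] by (simp add: eq set_integrable_def)
  show "f integrable_on {0..x}"
    using set_borel_integral_eq_integral(1)[OF si] .
  have "has_bochner_integral lborel
      (\<lambda>x. exp (- \<theta> * x) * (LINT y|?\<mu>. indicator {0..} (x - y))) (1 / \<theta> * l)"
  proof (rule laplace_transform_convolution)
    show "sigma_finite_measure ?\<mu>"
      by (subst sigma_finite_measure.sigma_finite_iff_density_finite)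
        (auto intro: lborel.sigma_finite_measure_axioms)
    show "integrable ?\<mu> (\<lambda>y. indicator {0..} (x - y) :: real)" for x
      using int[of x] nonneg by (subst integrable_density) auto
    show "has_bochner_integral ?\<mu> (\<lambda>y. exp (- \<theta> * y)) l"
      using L nonneg by (intro has_bochner_integral_density) (auto simp: mult.commute)
  qed (use laplace_transform_Heaviside[OF \<theta>] in auto)
  moreover have "(LINT y|?\<mu>. indicator {0..} (x - y)) = integral {0..x} f" for x
    using nonneg set_borel_integral_eq_integral(2)[OF si, of x]
    by (subst integral_density) (auto simp: eq set_lebesgue_integral_def)
  ultimately show "has_bochner_integral lborel (\<lambda>x. exp (- \<theta> * x) * integral {0..x} f) (l / \<theta>)"
    by simp
qed

section \<open>Injectivity of the Laplace transform on continuous functions\<close>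

text \<open>A continuous function of \<open>exp (- x)\<close> is a uniform limit of polynomials in \<open>exp (- x)\<close>, so it is
  orthogonal to every integrable \<open>h\<close> whose Laplace transform vanishes at the natural numbers.\<close>

lemma integral_exp_test_function_eq_0:
  fixes h g :: "real \<Rightarrow> real"
  assumes h: "integrable lborel h" and supp: "\<And>x. x < 0 \<Longrightarrow> h x = 0"
    and mom: "\<And>n. (LINT x|lborel. exp (- x) ^ n * h x) = 0"
    and g: "continuous_on UNIV g"
  shows "integrable lborel (\<lambda>x. g (exp (- x)) * h x)"
    and "(LINT x|lborel. g (exp (- x)) * h x) = 0"
proof -
  \<comment> \<open>Since \<open>h\<close> lives on \<open>x \<ge> 0\<close>, where
    \<open>exp (- x)\<close> is in \<open>(0, 1]\<close>, only the supremum of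
    \<open>\<bar>f\<bar>\<close> on \<open>[0, 1]\<close> matters. This serves for \<open>g\<close>,
    for the powers and for the approximation error.\<close>
  have *: "integrable lborel (\<lambda>x. f (exp (- x)) * h x) \<and>
      \<bar>LINT x|lborel. f (exp (- x)) * h x\<bar> \<le> C * (LINT x|lborel. \<bar>h x\<bar>)"
    if f: "continuous_on UNIV f" and C: "\<And>u. u \<in> {0..1} \<Longrightarrow> \<bar>f u\<bar> \<le> C" for f :: "real \<Rightarrow> real" and C
  proof
    have [measurable]: "f \<in> borel_measurable borel" "h \<in> borel_measurable borel"
      using f h by (auto intro: borel_measurable_continuous_onI)
    have le: "norm (f (exp (- x)) * h x) \<le> C * \<bar>h x\<bar>" for x
      using C[of "exp (- x)"] supp[of x]
      by (cases "x < 0") (auto simp: abs_mult intro!: mult_right_mono)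
    have int: "integrable lborel (\<lambda>x. C * \<bar>h x\<bar>)" using h by simp
    show *: "integrable lborel (\<lambda>x. f (exp (- x)) * h x)"
      by (rule Bochner_Integration.integrable_bound[OF int])
        (auto intro!: order_trans[OF le[unfolded real_norm_def] abs_ge_self])
    show "\<bar>LINT x|lborel. f (exp (- x)) * h x\<bar> \<le> C * (LINT x|lborel. \<bar>h x\<bar>)"
      using Bochner_Integration.integral_norm_bound_integral[OF * int le] by simp
  qed
  obtain C where C: "\<And>u. u \<in> {0..1} \<Longrightarrow> \<bar>g u\<bar> \<le> C"
    using compact_imp_bounded[OF compact_continuous_image[OF continuous_on_subset[OF g], of "{0..1}"]]
    by (auto simp: bounded_iff simp del: atLeastAtMost_iff)
  show int: "integrable lborel (\<lambda>x. g (exp (- x)) * h x)" using *[OF g C] by blast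
  let ?H = "LINT x|lborel. \<bar>h x\<bar>"
  have bound: "\<bar>LINT x|lborel. g (exp (- x)) * h x\<bar> \<le> e * ?H" if "0 < e" for e
  proof -
    obtain p where p: "real_polynomial_function p" "\<And>u. u \<in> {0..1} \<Longrightarrow> \<bar>g u - p u\<bar> < e"
      using Stone_Weierstrass_real_polynomial_function[OF _ continuous_on_subset[OF g], of "{0..1}" e]
        \<open>0 < e\<close> by auto
    then obtain a n where pn: "p = (\<lambda>u. \<Sum>i\<le>n. a i * u ^ i)"
      by (auto simp: real_polynomial_function_iff_sum)
    have pow: "integrable lborel (\<lambda>x. exp (- x) ^ i * h x)" for i
      by (rule *[of "\<lambda>u. u ^ i" 1, THEN conjunct1]) (auto intro!: continuous_intros power_le_one)
    have "(LINT x|lborel. p (exp (- x)) * h x) = (LINT x|lborel. (\<Sum>i\<le>n. a i * (exp (- x) ^ i * h x)))"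
      by (simp add: pn sum_distrib_right mult.assoc)
    also have "\<dots> = 0"
      using pow mom by (subst Bochner_Integration.integral_sum) auto
    finally have p0: "(LINT x|lborel. p (exp (- x)) * h x) = 0" .
    have cp: "continuous_on UNIV p" by (auto simp: pn intro!: continuous_intros)
    have d: "continuous_on UNIV (\<lambda>u. g u - p u)" using g cp by (intro continuous_intros)
    have "integrable lborel (\<lambda>x. p (exp (- x)) * h x)"
      using pow by (auto simp: pn sum_distrib_right mult.assoc intro!: Bochner_Integration.integrable_sum)
    then have "(LINT x|lborel. (g (exp (- x)) - p (exp (- x))) * h x) = (LINT x|lborel. g (exp (- x)) * h x)"
      using int p0 by (simp add: left_diff_distrib)
    with *[OF d, of e] p(2) show ?thesis by (auto simp: less_imp_le)
  qed
  have "((\<lambda>e. e * ?H) \<longlongrightarrow> 0 * ?H) (at_right 0)" by (intro tendsto_intros)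
  then have "\<bar>LINT x|lborel. g (exp (- x)) * h x\<bar> \<le> 0"
    by (intro tendsto_lowerbound[of "\<lambda>e. e * ?H" _ "at_right 0"])
      (auto simp: eventually_at_right_field intro!: exI[of _ 1] bound)
  then show "(LINT x|lborel. g (exp (- x)) * h x) = 0" by simp
qed

text \<open>If \<open>f x > 0\<close>, then \<open>f\<close> is positive on some
  \<open>(x, x + d)\<close>, and a bump supported there would have zero integral against a positive
  function. The interval lies to the right of \<open>x\<close>, so that \<open>x = 0\<close> is no
  exception.\<close>

lemma laplace_transform_zero_imp_not_pos:
  fixes f :: "real \<Rightarrow> real"
  assumes cont: "continuous_on {0..} f"
    and L: "\<And>\<theta>. a < \<theta> \<Longrightarrow> has_bochner_integral lborel (\<lambda>x. indicator {0..} x * (exp (- \<theta> * x) * f x)) 0"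
    and x: "0 \<le> x"
  shows "f x \<le> 0"
proof (rule ccontr)
  assume "\<not> f x \<le> 0"
  then have pos: "0 < f x" by simp
  have "eventually (\<lambda>y. 0 < f y) (at x within {0..})"
    using cont x pos by (intro order_tendstoD(1)[of f "f x"]) (auto simp: continuous_on_def)
  then obtain d where d: "0 < d" "\<And>y. 0 \<le> y \<Longrightarrow> y \<noteq> x \<Longrightarrow> dist y x < d \<Longrightarrow> 0 < f y"
    by (auto simp: eventually_at)
  have fpos: "0 < f y" if "x < y" "y < x + d" for y
    using d(2)[of y] that x by (auto simp: dist_real_def)
  \<comment> \<open>The exponent \<open>a + 1\<close> makes \<open>h\<close> integrable and turns
    its moments against \<open>exp (- x) ^ n\<close> into the vanishing transforms of
    \<open>f\<close> at \<open>a + 1 + n\<close>.\<close>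
  define h where "h = (\<lambda>x. indicator {0..} x * (exp (- (a + 1) * x) * f x))"
  \<comment> \<open>Positive part of a quadratic with roots \<open>exp (- (x + d))\<close> and
    \<open>exp (- x)\<close>; thus \<open>g (exp (- y)) > 0\<close> exactly for
    \<open>x < y < x + d\<close>.\<close>
  define g where "g = (\<lambda>u. max 0 ((u - exp (- (x + d))) * (exp (- x) - u)))"
  have mom: "(LINT x|lborel. exp (- x) ^ n * h x) = 0" for n
  proof -
    have "exp (- x) ^ n * h x = indicator {0..} x * (exp (- (a + 1 + real n) * x) * f x)" for x
      by (simp add: h_def exp_of_nat_mult[symmetric] algebra_simps flip: exp_add)
    then show ?thesis using L[of "a + 1 + real n"] by (auto simp: has_bochner_integral_iff)
  qed
  have h: "integrable lborel h" using L[of "a + 1"] by (auto simp: h_def has_bochner_integral_iff)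
  have g: "continuous_on UNIV g" by (auto simp: g_def intro!: continuous_intros)
  have gpos: "0 < g (exp (- y))" if "x < y" "y < x + d" for y
    using that by (auto simp: g_def less_max_iff_disj)
  have g0: "g (exp (- y)) = 0" if "\<not> (x < y \<and> y < x + d)" for y
    using that \<open>0 < d\<close> by (auto simp: g_def not_less mult_nonneg_nonpos mult_nonpos_nonneg intro!: max_absorb1)
  note I = integral_exp_test_function_eq_0[OF h _ mom g]
  have hpos: "0 < h y" if "x < y" "y < x + d" for y
    using fpos[OF that] that x by (auto simp: h_def)
  have nn: "0 \<le> g (exp (- y)) * h y" for y
    using g0[of y] gpos[of y] hpos[of y] by (cases "x < y \<and> y < x + d") auto
  have "AE y in lborel. g (exp (- y)) * h y = 0"
    using I nn by (subst integral_nonneg_eq_0_iff_AE[symmetric]) (auto simp: h_def)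
  then have "AE y in lborel. y \<notin> {x<..<x + d}"
  proof eventually_elim
    case (elim y)
    then show ?case using gpos[of y] hpos[of y] by auto
  qed
  then have "emeasure lborel {x<..<x + d} = 0"
    by (subst (asm) AE_iff_measurable[of "{x<..<x + d}"]) auto
  then show False using \<open>0 < d\<close> by simp
qed

lemma laplace_transform_zero_imp_zero:
  fixes f :: "real \<Rightarrow> real"
  assumes cont: "continuous_on {0..} f"
    and L: "\<And>\<theta>. a < \<theta> \<Longrightarrow> has_bochner_integral lborel (\<lambda>x. indicator {0..} x * (exp (- \<theta> * x) * f x)) 0"
    and x: "0 \<le> x"
  shows "f x = 0"
proof (rule antisym)
  show "f x \<le> 0" by (rule laplace_transform_zero_imp_not_pos[OF assms])
  have "- f x \<le> 0"
    by (rule laplace_transform_zero_imp_not_pos[of "\<lambda>x. - f x" a])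
      (use cont x has_bochner_integral_minus[OF L] in \<open>auto intro!: continuous_intros\<close>)
  then show "0 \<le> f x" by simp
qed

section \<open>The scale function of a process with finite jump measure\<close>

lemma continuous_on_primitive:
  fixes f :: "real \<Rightarrow> real"
  assumes "\<And>b. f integrable_on {0..b}"
  shows "continuous_on {0..} (\<lambda>x. integral {0..x} f)"
proof -
  have "continuous (at x within {0..}) (\<lambda>x. integral {0..x} f)" if "0 \<le> x" for x
  proof -
    have "continuous (at x within {0..x + 1}) (\<lambda>x. integral {0..x} f)"
      using indefinite_integral_continuous_1[OF assms[of "x + 1"]] that
      by (auto simp: continuous_on_eq_continuous_within)
    moreover have "at x within {0..} = at x within {0..x + 1}"
      by (rule at_within_nhd[where S = "{..<x + 1}"]) auto
    ultimately show ?thesis by simp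
  qed
  then show ?thesis by (auto simp: continuous_on_eq_continuous_within)
qed

lemma has_real_derivative_primitive:
  fixes f :: "real \<Rightarrow> real"
  assumes "\<And>b. continuous_on {0..b} f" and "0 \<le> x"
  shows "((\<lambda>x. integral {0..x} f) has_real_derivative f x) (at x within {0..})"
proof -
  have "((\<lambda>x. integral {0..x} f) has_real_derivative f x) (at x within {0..x + 1})"
    using assms by (intro integral_has_real_derivative) auto
  moreover have "at x within {0..} = at x within {0..x + 1}"
    by (rule at_within_nhd[where S = "{..<x + 1}"]) auto
  ultimately show ?thesis by simp
qed

lemma continuous_on_extend_const:
  fixes f :: "real \<Rightarrow> real"
  assumes "continuous_on {0..} f" and "\<And>x. x < 0 \<Longrightarrow> f x = f 0"
  shows "continuous_on UNIV f"
proof -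
  have "continuous_on UNIV (\<lambda>x. f (max 0 x))"
    by (rule continuous_on_compose2[OF assms(1)]) (auto intro!: continuous_intros)
  moreover have "f (max 0 x) = f x" for x
    using assms(2)[of x] by (auto simp: max_def)
  ultimately show ?thesis by simp
qed

lemma AE_pos_if_null_nonpos:
  fixes \<nu> :: "real measure"
  assumes "sets \<nu> = sets borel" "emeasure \<nu> {..0} = 0"
  shows "AE y in \<nu>. 0 < y"
proof -
  have "{x \<in> space \<nu>. \<not> 0 < x} = {..0}"
    using sets_eq_imp_space_eq[OF assms(1)] by auto
  with assms show ?thesis by (subst AE_iff_measurable[of "{..0}"]) auto
qed

section \<open>Transforms of \<open>W\<close> and of its convolution with \<nu>, and the integral
  equation\<close>

locale finite_jump_scale_function = finite_measure \<nu> for \<nu> :: "real measure" +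
  fixes \<gamma> \<sigma> q :: real and W :: "real \<Rightarrow> real"
  assumes sets_nu [measurable_cong]: "sets \<nu> = sets borel"
    and AE_pos: "AE y in \<nu>. 0 < y"
    and sigma_pos: "0 < \<sigma>"
    and scale: "is_scale_function \<gamma> \<sigma> \<nu> q W"
begin

definition "rate = measure \<nu> (space \<nu>)"
definition "drift = \<gamma> + (LINT y|\<nu>. y * indicator {0<..<1} y)"
definition "jump_conv x = (LINT y|\<nu>. W (x - y))"

lemma W_nonneg: "0 \<le> W x" and W_neg: "x < 0 \<Longrightarrow> W x = 0"
  using scale by (auto simp: is_scale_function_def)

lemma W_mono: "x \<le> y \<Longrightarrow> W x \<le> W y"
  using scale W_nonneg W_neg strict_mono_onD[of "{0..}" W x y]
  by (cases "x < 0"; cases "x = y") (auto simp: is_scale_function_def intro: less_imp_le)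

lemma W_measurable [measurable]: "W \<in> borel_measurable borel"
  by (rule borel_measurable_mono) (simp add: mono_def W_mono)

lemma integrable_W_shift: "integrable \<nu> (\<lambda>y. W (x - y))"
  by (rule integrable_const_bound[where B = "W x"])
    (auto intro!: eventually_mono[OF AE_pos] W_mono simp: W_nonneg)

lemma jump_conv_nonneg: "0 \<le> jump_conv x"
  by (simp add: jump_conv_def W_nonneg)

lemma jump_conv_neg: "x < 0 \<Longrightarrow> jump_conv x = 0"
  unfolding jump_conv_def
  by (intro integral_eq_zero_AE eventually_mono[OF AE_pos]) (auto intro: W_neg)

lemma integrable_truncated_id: "integrable \<nu> (\<lambda>y. y * indicator {0<..<1} y)"
  by (rule integrable_const_bound[where B = 1]) (auto simp: indicator_def)

lemma integrable_exp: "0 \<le> \<theta> \<Longrightarrow> integrable \<nu> (\<lambda>y. exp (- \<theta> * y))"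
  by (rule integrable_const_bound[where B = 1]) (use AE_pos in auto)

lemma set_integral_pos:
  fixes g :: "real \<Rightarrow> real"
  assumes g: "integrable \<nu> g"
  shows "set_integrable \<nu> {0<..} g" "(LINT y:{0<..}|\<nu>. g y) = (LINT y|\<nu>. g y)"
proof -
  show "set_integrable \<nu> {0<..} g"
    unfolding set_integrable_def using g by (intro integrable_mult_indicator) (auto simp: sets_nu)
  show "(LINT y:{0<..}|\<nu>. g y) = (LINT y|\<nu>. g y)"
    unfolding set_lebesgue_integral_def using AE_pos g
    by (intro integral_cong_AE) (auto simp: borel_measurable_integrable)
qed

text \<open>Finiteness of \<nu> makes each term of the compensated integrand integrable by itself,
  so the integral splits and the compensator joins the linear term.\<close>

lemma laplace_exponent_eq:
  assumes "0 \<le> \<theta>"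
  shows "laplace_exponent \<gamma> \<sigma> \<nu> \<theta>
    = drift * \<theta> + \<sigma>\<^sup>2 * \<theta>\<^sup>2 / 2 - rate + (LINT y|\<nu>. exp (- \<theta> * y))"
proof -
  have 1: "integrable \<nu> (\<lambda>y. \<theta> * y * indicator {0<..<1} y)"
    using integrable_mult_right[OF integrable_truncated_id, of \<theta>] by (simp add: mult.assoc)
  have "(LINT z:{0<..}|\<nu>. 1 - exp (- \<theta> * z) - \<theta> * z * indicator {0<..<1} z)
      = (LINT z|\<nu>. 1 - exp (- \<theta> * z) - \<theta> * z * indicator {0<..<1} z)"
    using 1 integrable_exp[OF assms] by (intro set_integral_pos) auto
  also have "\<dots> = rate - (LINT y|\<nu>. exp (- \<theta> * y)) - (LINT y|\<nu>. \<theta> * y * indicator {0<..<1} y)"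
    using 1 integrable_exp[OF assms] by (simp add: rate_def)
  also have "(LINT y|\<nu>. \<theta> * y * indicator {0<..<1} y) = \<theta> * (LINT y|\<nu>. y * indicator {0<..<1} y)"
    by (simp add: mult.assoc)
  finally show ?thesis by (simp add: laplace_exponent_def drift_def algebra_simps)
qed

text \<open>Provides one threshold beyond which both transforms converge and the denominator is
  positive.\<close>

lemma laplace_transforms:
  obtains a where "0 \<le> a"
    "\<And>\<theta>. a < \<theta> \<Longrightarrow> q < laplace_exponent \<gamma> \<sigma> \<nu> \<theta>"
    "\<And>\<theta>. a < \<theta> \<Longrightarrow> has_bochner_integral lborel (\<lambda>x. exp (- \<theta> * x) * W x)
       (1 / (laplace_exponent \<gamma> \<sigma> \<nu> \<theta> - q))"
    "\<And>\<theta>. a < \<theta> \<Longrightarrow> has_bochner_integral lborel (\<lambda>x. exp (- \<theta> * x) * jump_conv x)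
       (1 / (laplace_exponent \<gamma> \<sigma> \<nu> \<theta> - q) * (LINT y|\<nu>. exp (- \<theta> * y)))"
proof -
  \<comment> \<open>As \<sigma> is positive, the quadratic term wins; the transform of \<nu> is
    nonnegative and can be left out of the lower bound.\<close>
  have "filterlim (\<lambda>\<theta>. drift * \<theta> + \<sigma>\<^sup>2 * \<theta>\<^sup>2 / 2 - rate) at_top at_top"
    using sigma_pos by real_asymp
  then obtain b where b: "\<And>\<theta>. b < \<theta> \<Longrightarrow> q < drift * \<theta> + \<sigma>\<^sup>2 * \<theta>\<^sup>2 / 2 - rate"
    by (auto simp: filterlim_at_top_dense eventually_at_top_dense)
  \<comment> \<open>The three bounds ensure, in turn, integrability of the exponential under \<nu>,
    positivity of the denominator, and the defining identity of \<open>W\<close>.\<close>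
  define a where "a = max 0 (max b (right_inverse_exponent \<gamma> \<sigma> \<nu> q))"
  have W: "has_bochner_integral lborel (\<lambda>x. exp (- \<theta> * x) * W x)
       (1 / (laplace_exponent \<gamma> \<sigma> \<nu> \<theta> - q))" if "a < \<theta>" for \<theta>
  proof -
    have eq: "indicator {0..} x *\<^sub>R (exp (- \<theta> * x) * W x) = exp (- \<theta> * x) * W x" for x
      using W_neg[of x] by (auto simp: indicator_def)
    have "set_integrable lborel {0..} (\<lambda>x. exp (- \<theta> * x) * W x)"
      "(LBINT x:{0..}. exp (- \<theta> * x) * W x) = 1 / (laplace_exponent \<gamma> \<sigma> \<nu> \<theta> - q)"
      using scale that by (auto simp: is_scale_function_def a_def)
    then show ?thesis
      unfolding set_integrable_def set_lebesgue_integral_def eq by (simp add: has_bochner_integral_iff)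
  qed
  show ?thesis
  proof (rule that[of a])
    show "0 \<le> a" by (simp add: a_def)
    fix \<theta> assume \<theta>: "a < \<theta>"
    have "0 \<le> (LINT y|\<nu>. exp (- \<theta> * y))" by (rule Bochner_Integration.integral_nonneg) simp
    moreover have "q < drift * \<theta> + \<sigma>\<^sup>2 * \<theta>\<^sup>2 / 2 - rate" and "0 \<le> \<theta>"
      using b[of \<theta>] \<theta> by (auto simp: a_def)
    ultimately show "q < laplace_exponent \<gamma> \<sigma> \<nu> \<theta>"
      unfolding laplace_exponent_eq[OF \<open>0 \<le> \<theta>\<close>] by linarith
    show "has_bochner_integral lborel (\<lambda>x. exp (- \<theta> * x) * W x)
       (1 / (laplace_exponent \<gamma> \<sigma> \<nu> \<theta> - q))" by (rule W[OF \<theta>])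
    show "has_bochner_integral lborel (\<lambda>x. exp (- \<theta> * x) * jump_conv x)
       (1 / (laplace_exponent \<gamma> \<sigma> \<nu> \<theta> - q) * (LINT y|\<nu>. exp (- \<theta> * y)))"
      unfolding jump_conv_def using \<theta> integrable_exp[of \<theta>]
      by (intro laplace_transform_convolution W integrable_W_shift)
        (auto simp: sets_nu W_nonneg a_def has_bochner_integral_iff intro: sigma_finite_measure_axioms)
  qed
qed

lemma integrable_on_W: "W integrable_on {0..x}"
  and integrable_on_jump_conv: "jump_conv integrable_on {0..x}"
proof -
  obtain a where a: "0 \<le> a" and L:
    "\<And>\<theta>. a < \<theta> \<Longrightarrow> has_bochner_integral lborel (\<lambda>x. exp (- \<theta> * x) * W x)
       (1 / (laplace_exponent \<gamma> \<sigma> \<nu> \<theta> - q))"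
    "\<And>\<theta>. a < \<theta> \<Longrightarrow> has_bochner_integral lborel (\<lambda>x. exp (- \<theta> * x) * jump_conv x)
       (1 / (laplace_exponent \<gamma> \<sigma> \<nu> \<theta> - q) * (LINT y|\<nu>. exp (- \<theta> * y)))"
    by (rule laplace_transforms) blast
  show "W integrable_on {0..x}"
    by (rule laplace_transform_primitive(1)[OF W_nonneg W_neg _ L(1)[of "a + 1"]]) (use a in auto)
  show "jump_conv integrable_on {0..x}"
    by (rule laplace_transform_primitive(1)[OF jump_conv_nonneg jump_conv_neg _ L(2)[of "a + 1"]])
      (use a in auto)
qed

text \<open>Primitive of the zero-order terms of the equation for \<open>W\<close>. It vanishes for
  \<open>x < 0\<close>, where the intervals are empty, so its continuity extends to the whole
  line.\<close>

definition "remainder x = integral {0..x} jump_conv - (rate + q) * integral {0..x} W"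

lemma remainder_cont: "continuous_on {0..} remainder"
  unfolding remainder_def
  by (intro continuous_intros continuous_on_primitive integrable_on_W integrable_on_jump_conv)

text \<open>The identity for the Laplace transform of \<open>W\<close>, divided by \<open>\<theta>\<^sup>2\<close> so that each term is
  the transform of a continuous function.\<close>

lemma W_integral_equation:
  assumes "0 \<le> x"
  shows "\<sigma>\<^sup>2 / 2 * W x = x - drift * integral {0..x} W - integral {0..x} remainder"
proof -
  let ?I = "\<lambda>f x. integral {0..x} (f :: real \<Rightarrow> real)"
  let ?U = "indicator {0..} :: real \<Rightarrow> real"
  obtain a where a: "0 \<le> a" and gt: "\<And>\<theta>. a < \<theta> \<Longrightarrow> q < laplace_exponent \<gamma> \<sigma> \<nu> \<theta>" and L:
    "\<And>\<theta>. a < \<theta> \<Longrightarrow> has_bochner_integral lborel (\<lambda>x. exp (- \<theta> * x) * W x)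
       (1 / (laplace_exponent \<gamma> \<sigma> \<nu> \<theta> - q))"
    "\<And>\<theta>. a < \<theta> \<Longrightarrow> has_bochner_integral lborel (\<lambda>x. exp (- \<theta> * x) * jump_conv x)
       (1 / (laplace_exponent \<gamma> \<sigma> \<nu> \<theta> - q) * (LINT y|\<nu>. exp (- \<theta> * y)))"
    by (rule laplace_transforms) blast
  \<comment> \<open>Here \<open>D\<close> is the Laplace exponent minus \<open>q\<close>,
    \<open>t\<close> is \<theta>, \<open>m\<close> the transform of \<nu> and \<open>r\<close> is
    \<open>rate + q\<close>; \<open>laplace_exponent_eq\<close> then makes the numerator on the
    right vanish.\<close>
  have identity: "s / 2 * (1 / D) + c * (1 / D / t) + 1 / D * m / t / t - r * (1 / D / t / t) - 1 / t / t
      = (s * t\<^sup>2 / 2 + c * t + m - r - D) / (D * t\<^sup>2)" if "D \<noteq> 0" "t \<noteq> 0"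
    for s D c t m r :: real
    using that by (simp add: divide_simps power2_eq_square) (simp add: algebra_simps)
  have pos: "0 < \<theta>" if "a < \<theta>" for \<theta> using a that by simp
  \<comment> \<open>Taking primitives of transforms requires nonnegative functions, so
    \<open>W\<close> and \<open>jump_conv\<close> are integrated twice separately and combined into
    \<open>remainder\<close>, whose sign is not known, only at the end.\<close>
  have I_nonneg: "0 \<le> ?I W x" "0 \<le> ?I jump_conv x" for x
    using integrable_on_W integrable_on_jump_conv W_nonneg jump_conv_nonneg
    by (auto intro!: Henstock_Kurzweil_Integration.integral_nonneg)
  note LW = laplace_transform_primitive(2)[OF W_nonneg W_neg pos L(1)]
  note LJ = laplace_transform_primitive(2)[OF jump_conv_nonneg jump_conv_neg pos L(2)]
  have neg: "x < 0 \<Longrightarrow> ?I f x = 0" for f x by simp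
  note IW = laplace_transform_primitive[OF I_nonneg(1) neg pos LW]
  note IJ = laplace_transform_primitive[OF I_nonneg(2) neg pos LJ]
  \<comment> \<open>The term \<open>x\<close> enters as the primitive of the Heaviside function,
    which supplies its transform and the value 0 on the negative half-line.\<close>
  have LU: "has_bochner_integral lborel (\<lambda>x. exp (- \<theta> * x) * ?I ?U x) (1 / \<theta> / \<theta>)" if "a < \<theta>" for \<theta>
    by (rule laplace_transform_primitive(2)[OF _ _ pos[OF that] laplace_transform_Heaviside])
      (use pos[OF that] in auto)
  have U: "?I ?U x = x" if "0 \<le> x" for x
  proof -
    have "?I ?U x = ?I (\<lambda>_. 1) x"
      by (intro Henstock_Kurzweil_Integration.integral_cong) auto
    then show ?thesis using that by simp
  qed
  have int: "?I W integrable_on {0..x}" "?I jump_conv integrable_on {0..x}" for x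
    using IW(1)[of "a + 1"] IJ(1)[of "a + 1"] by auto
  define F where "F x = \<sigma>\<^sup>2 / 2 * W x + drift * ?I W x + ?I (?I jump_conv) x
      - (rate + q) * ?I (?I W) x - ?I ?U x" for x
  have "F x = 0"
  proof (rule laplace_transform_zero_imp_zero[OF _ _ assms])
    have "?U integrable_on {0..x}" for x
      by (rule laplace_transform_primitive(1)[OF _ _ zero_less_one laplace_transform_Heaviside]) auto
    then show "continuous_on {0..} F"
      unfolding F_def using scale
      by (intro continuous_intros continuous_on_primitive int integrable_on_W)
        (auto simp: is_scale_function_def)
    fix \<theta> assume \<theta>: "a < \<theta>"
    let ?D = "laplace_exponent \<gamma> \<sigma> \<nu> \<theta> - q" and ?m = "LINT y|\<nu>. exp (- \<theta> * y)"
    have "has_bochner_integral lborel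
      (\<lambda>x. \<sigma>\<^sup>2 / 2 * (exp (- \<theta> * x) * W x) + drift * (exp (- \<theta> * x) * ?I W x)
        + exp (- \<theta> * x) * ?I (?I jump_conv) x
        - (rate + q) * (exp (- \<theta> * x) * ?I (?I W) x) - exp (- \<theta> * x) * ?I ?U x)
      (\<sigma>\<^sup>2 / 2 * (1 / ?D) + drift * (1 / ?D / \<theta>) + 1 / ?D * ?m / \<theta> / \<theta>
        - (rate + q) * (1 / ?D / \<theta> / \<theta>) - 1 / \<theta> / \<theta>)"
      by (intro has_bochner_integral_add has_bochner_integral_diff has_bochner_integral_mult_right
          L LW IW IJ LU \<theta>)
    also have "\<sigma>\<^sup>2 / 2 * (1 / ?D) + drift * (1 / ?D / \<theta>) + 1 / ?D * ?m / \<theta> / \<theta>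
        - (rate + q) * (1 / ?D / \<theta> / \<theta>) - 1 / \<theta> / \<theta>
      = (\<sigma>\<^sup>2 * \<theta>\<^sup>2 / 2 + drift * \<theta> + ?m - (rate + q) - ?D) / (?D * \<theta>\<^sup>2)"
      by (rule identity) (use gt[OF \<theta>] pos[OF \<theta>] in auto)
    also have "\<dots> = 0"
      using pos[OF \<theta>] by (simp add: laplace_exponent_eq)
    \<comment> \<open>For \<open>x < 0\<close> all terms vanish, being \<open>W\<close> or integrals
      over empty intervals, so the indicator changes nothing.\<close>
    also have "(\<lambda>x. \<sigma>\<^sup>2 / 2 * (exp (- \<theta> * x) * W x) + drift * (exp (- \<theta> * x) * ?I W x)
        + exp (- \<theta> * x) * ?I (?I jump_conv) x
        - (rate + q) * (exp (- \<theta> * x) * ?I (?I W) x) - exp (- \<theta> * x) * ?I ?U x)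
      = (\<lambda>x. indicator {0..} x * (exp (- \<theta> * x) * F x))"
      by (auto simp: F_def fun_eq_iff indicator_def W_neg algebra_simps)
    finally show "has_bochner_integral lborel (\<lambda>x. indicator {0..} x * (exp (- \<theta> * x) * F x)) 0" .
  qed
  moreover have "?I remainder x = ?I (?I jump_conv) x - (rate + q) * ?I (?I W) x"
    unfolding remainder_def using int
    by (subst Henstock_Kurzweil_Integration.integral_diff) (auto intro: integrable_on_mult_right)
  ultimately show ?thesis using U[OF assms] by (simp add: F_def algebra_simps)
qed

section \<open>First derivative of \<open>W\<close> and its behaviour at the origin\<close>

lemma W_0: "W 0 = 0"
  using W_integral_equation[of 0] sigma_pos by simp

lemma W_continuous: "continuous_on UNIV W"
  using scale by (intro continuous_on_extend_const) (auto simp: is_scale_function_def W_0 W_neg)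

lemma remainder_continuous: "continuous_on UNIV remainder"
  by (rule continuous_on_extend_const[OF remainder_cont]) (simp add: remainder_def)

text \<open>The formula results from differentiating the integral equation. At 0 it gives the right
  derivative \<open>2 / \<sigma>\<^sup>2\<close>, so \<open>W'\<close> jumps there.\<close>

definition "W' x = (if x < 0 then 0 else 2 / \<sigma>\<^sup>2 * (1 - drift * W x - remainder x))"

lemma W'_neg: "x < 0 \<Longrightarrow> W' x = 0"
  by (simp add: W'_def)

lemma W'_measurable [measurable]: "W' \<in> borel_measurable borel"
proof -
  have [measurable]: "remainder \<in> borel_measurable borel"
    by (rule borel_measurable_continuous_onI[OF remainder_continuous])
  show ?thesis unfolding W'_def by measurable
qed

lemma W_has_derivative_within:
  assumes x: "0 \<le> x"
  shows "(W has_real_derivative W' x) (at x within {0..})"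
proof -
  have "((\<lambda>x. 2 / \<sigma>\<^sup>2 * (x - drift * integral {0..x} W - integral {0..x} remainder))
      has_real_derivative W' x) (at x within {0..})"
  proof (rule DERIV_cong)
    show "((\<lambda>x. 2 / \<sigma>\<^sup>2 * (x - drift * integral {0..x} W - integral {0..x} remainder))
      has_real_derivative 2 / \<sigma>\<^sup>2 * (1 - drift * W x - remainder x)) (at x within {0..})"
      using x
      by (intro DERIV_cmult DERIV_diff DERIV_ident has_real_derivative_primitive
          continuous_on_subset[OF W_continuous] continuous_on_subset[OF remainder_continuous]) auto
  qed (use x in \<open>simp add: W'_def\<close>)
  moreover have "2 / \<sigma>\<^sup>2 * (x - drift * integral {0..x} W - integral {0..x} remainder) = W x"
    if "0 \<le> x" for x
    using W_integral_equation[OF that] sigma_pos by (simp add: field_simps)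
  ultimately show ?thesis
    using x by (elim has_field_derivative_transform_within[of _ _ _ _ 1]) auto
qed

lemma W_has_derivative_at_right: "(W has_real_derivative W' x) (at_right x)"
proof (cases "x < 0")
  case True
  have "((\<lambda>_. 0) has_real_derivative W' x) (at x)"
    using True by (simp add: W'_neg)
  then have "(W has_real_derivative W' x) (at x)"
    by (rule has_field_derivative_transform_within[of _ _ _ _ "- x"])
      (use True in \<open>auto simp: dist_real_def W_neg\<close>)
  then show ?thesis by (rule has_field_derivative_at_within)
next
  case False
  then show ?thesis
    by (intro has_field_derivative_subset[OF W_has_derivative_within]) auto
qed

lemma W_has_derivative:
  assumes "0 < x"
  shows "(W has_real_derivative W' x) (at x)"
  using W_has_derivative_within[of x] assms
  by (simp add: at_within_interior[of x "{0..}"])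

lemma right_deriv_W: "right_deriv W = W'"
proof
  fix x
  show "right_deriv W x = W' x"
    unfolding right_deriv_def using W_has_derivative_at_right[of x]
    by (intro vector_derivative_within)
       (auto simp: has_real_derivative_iff_has_vector_derivative trivial_limit_at_right_real)
qed

text \<open>\<open>W'\<close> is continuous on \<open>[0, b]\<close> despite its jump at 0, and zero
  to the left. The bound covers all \<open>x \<le> b\<close> because \<open>x - y\<close> may be
  arbitrarily negative under \<nu>.\<close>

lemma W'_bounded:
  obtains K where "0 \<le> K" "\<And>x. x \<le> b \<Longrightarrow> \<bar>W' x\<bar> \<le> K"
proof -
  have "continuous_on {0..b} (\<lambda>x. 2 / \<sigma>\<^sup>2 * (1 - drift * W x - remainder x))"
    by (intro continuous_intros continuous_on_subset[OF W_continuous]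
        continuous_on_subset[OF remainder_continuous]) auto
  then have "continuous_on {0..b} W'"
    by (rule continuous_on_eq) (simp add: W'_def)
  then have "bounded (W' ` {0..b})"
    by (intro compact_imp_bounded compact_continuous_image) auto
  then obtain K where K: "\<forall>x\<in>{0..b}. \<bar>W' x\<bar> \<le> K"
    by (auto simp: bounded_iff)
  have "\<bar>W' x\<bar> \<le> max 0 K" if "x \<le> b" for x
    using K that by (cases "x < 0") (auto simp: W'_neg max.coboundedI2)
  then show ?thesis by (intro that[of "max 0 K"]) auto
qed

text \<open>The jump of \<open>W'\<close> is avoided by moving both points to \<open>max 0 u\<close>
  and \<open>max 0 v\<close>: this does not alter \<open>W\<close>, as \<open>W 0 = 0\<close>, and
  does not increase their distance.\<close>

lemma W_lipschitz:
  assumes K: "0 \<le> K" "\<And>x. x \<le> b \<Longrightarrow> \<bar>W' x\<bar> \<le> K" and uv: "u \<le> b" "v \<le> b"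
  shows "\<bar>W u - W v\<bar> \<le> K * \<bar>u - v\<bar>"
proof (cases "b < 0")
  case True
  then show ?thesis using uv K by (simp add: W_neg)
next
  case False
  have "norm (W (max 0 u) - W (max 0 v)) \<le> K * norm (max 0 u - max 0 v)"
    by (rule field_differentiable_bound[of "{0..b}" W W'])
      (use K uv False in \<open>auto intro!: has_field_derivative_subset[OF W_has_derivative_within]\<close>)
  also have "\<dots> \<le> K * \<bar>u - v\<bar>"
    using K by (intro mult_left_mono) auto
  finally show ?thesis by (simp add: max_def W_0 W_neg split: if_splits)
qed

section \<open>Regularity of the convolution and the second derivative of \<open>W\<close>\<close>

lemma jump_conv_continuous: "continuous_on UNIV jump_conv"
proof -
  have "isCont jump_conv x" for x
  proof -
    obtain K where K: "0 \<le> K" "\<And>z. z \<le> x + 1 \<Longrightarrow> \<bar>W' z\<bar> \<le> K"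
      using W'_bounded by blast
    \<comment> \<open>For \<open>y > 0\<close> both \<open>u - y\<close> and \<open>x - y\<close>
      are below \<open>x + 1\<close>, so one Lipschitz constant of \<open>W\<close> serves all
      \<open>y\<close> and integrates to \<open>K * rate\<close>.\<close>
    have "norm (jump_conv u - jump_conv x) \<le> K * \<bar>u - x\<bar> * rate" if "u < x + 1" for u
    proof -
      have "norm (jump_conv u - jump_conv x) = norm (LINT y|\<nu>. W (u - y) - W (x - y))"
        by (simp add: jump_conv_def integrable_W_shift)
      also have "\<dots> \<le> (LINT y|\<nu>. norm (W (u - y) - W (x - y)))"
        by (rule integral_norm_bound)
      also have "\<dots> \<le> (LINT y|\<nu>. K * \<bar>u - x\<bar>)"
      proof (rule integral_mono_AE)
        show "AE y in \<nu>. norm (W (u - y) - W (x - y)) \<le> K * \<bar>u - x\<bar>"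
          using AE_pos
        proof eventually_elim
          case (elim y)
          have "\<bar>W (u - y) - W (x - y)\<bar> \<le> K * \<bar>u - y - (x - y)\<bar>"
            by (rule W_lipschitz[OF K]) (use elim that in auto)
          then show ?case by simp
        qed
      qed (auto intro!: integrable_norm Bochner_Integration.integrable_diff integrable_W_shift)
      finally show ?thesis by (simp add: rate_def mult_ac)
    qed
    then have "eventually (\<lambda>u. norm (jump_conv u - jump_conv x) \<le> K * \<bar>u - x\<bar> * rate) (at x)"
      by (auto simp: eventually_at dist_real_def intro!: exI[of _ 1])
    moreover have "((\<lambda>u. K * \<bar>u - x\<bar> * rate) \<longlongrightarrow> 0) (at x)"
      by (rule tendsto_eq_rhs[of _ "K * \<bar>x - x\<bar> * rate"]) (intro tendsto_intros, simp)
    ultimately have "((\<lambda>u. jump_conv u - jump_conv x) \<longlongrightarrow> 0) (at x)"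
      by (rule Lim_null_comparison)
    then show ?thesis by (simp add: isCont_def LIM_zero_iff)
  qed
  then show ?thesis by (simp add: continuous_on_eq_continuous_at)
qed

text \<open>Formal derivative of the formula for \<open>W'\<close>. Without a case distinction, it
  can be solved for \<open>jump_conv\<close> at every point.\<close>

definition "W'' x = 2 / \<sigma>\<^sup>2 * ((rate + q) * W x - drift * W' x - jump_conv x)"

text \<open>Continuity of \<open>jump_conv\<close> allows the fundamental theorem of calculus to
  differentiate \<open>remainder\<close>.\<close>

lemma W'_has_derivative:
  assumes x: "0 < x"
  shows "(W' has_real_derivative W'' x) (at x)"
proof -
  have "(remainder has_real_derivative jump_conv x - (rate + q) * W x) (at x within {0..})"
    unfolding remainder_def using x
    by (intro DERIV_diff DERIV_cmult has_real_derivative_primitive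
        continuous_on_subset[OF W_continuous] continuous_on_subset[OF jump_conv_continuous]) auto
  then have "(remainder has_real_derivative jump_conv x - (rate + q) * W x) (at x)"
    using x by (simp add: at_within_interior[of x "{0..}"])
  then have "((\<lambda>x. 2 / \<sigma>\<^sup>2 * (1 - drift * W x - remainder x)) has_real_derivative
      2 / \<sigma>\<^sup>2 * (0 - drift * W' x - (jump_conv x - (rate + q) * W x))) (at x)"
    by (intro DERIV_cmult DERIV_diff DERIV_const W_has_derivative x)
  then have "((\<lambda>x. 2 / \<sigma>\<^sup>2 * (1 - drift * W x - remainder x)) has_real_derivative W'' x) (at x)"
    by (rule DERIV_cong) (simp add: W''_def algebra_simps)
  then show ?thesis
    by (rule has_field_derivative_transform_within[of _ _ _ _ x])
      (use x in \<open>auto simp: W'_def dist_real_def\<close>)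
qed

lemma integrable_W'_shift: "integrable \<nu> (\<lambda>y. W' (x - y))"
proof -
  obtain K where K: "0 \<le> K" "\<And>z. z \<le> x \<Longrightarrow> \<bar>W' z\<bar> \<le> K" using W'_bounded by blast
  show ?thesis
    by (rule integrable_const_bound[where B = K]) (use AE_pos K in auto)
qed

text \<open>Dominated convergence with the Lipschitz constant as bound. Positive increments make the
  quotients converge to \<open>W'\<close> even at the origin, which matters when \<nu> has an atom
  at \<open>y = x\<close>; increments at most 1 keep all arguments below
  \<open>x + 1\<close>.\<close>

lemma jump_conv_difference_quotient:
  "(\<lambda>n. (jump_conv (x + inverse (real (Suc n))) - jump_conv x) / inverse (real (Suc n)))
    \<longlonglongrightarrow> (LINT y|\<nu>. W' (x - y))"
proof -
  obtain K where K: "0 \<le> K" "\<And>z. z \<le> x + 1 \<Longrightarrow> \<bar>W' z\<bar> \<le> K" using W'_bounded by blast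
  let ?h = "\<lambda>n. inverse (real (Suc n))"
  have h: "0 < ?h n" "?h n \<le> 1" for n by (auto simp: field_simps)
  have lim: "(\<lambda>n. (W (z + ?h n) - W z) / ?h n) \<longlonglongrightarrow> W' z" for z
  proof -
    have "filterlim (\<lambda>n. z + ?h n) (at_right z) sequentially"
      using LIMSEQ_inverse_real_of_nat_add[of z] h(1)
      by (subst filterlim_at) (auto intro!: always_eventually)
    from filterlim_compose[OF W_has_derivative_at_right[unfolded has_field_derivative_iff] this]
    show ?thesis by simp
  qed
  have "(\<lambda>n. LINT y|\<nu>. (W (x - y + ?h n) - W (x - y)) / ?h n) \<longlonglongrightarrow> (LINT y|\<nu>. W' (x - y))"
  proof (rule integral_dominated_convergence[where w = "\<lambda>_. K"])
    show "AE y in \<nu>. norm ((W (x - y + ?h n) - W (x - y)) / ?h n) \<le> K" for n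
      using AE_pos
    proof eventually_elim
      case (elim y)
      have "\<bar>W (x - y + ?h n) - W (x - y)\<bar> \<le> K * \<bar>x - y + ?h n - (x - y)\<bar>"
        using elim h(2)[of n] by (intro W_lipschitz[of K "x + 1"] K) linarith+
      also have "\<dots> = K * ?h n" using h(1)[of n] by simp
      finally show ?case
        using h(1)[of n] by (simp only: real_norm_def abs_divide abs_of_pos pos_divide_le_eq)
    qed
    show "AE y in \<nu>. (\<lambda>n. (W (x - y + ?h n) - W (x - y)) / ?h n) \<longlonglongrightarrow> W' (x - y)"
      by (intro AE_I2 lim)
  qed measurable
  moreover have "(LINT y|\<nu>. (W (x - y + ?h n) - W (x - y)) / ?h n)
      = (jump_conv (x + ?h n) - jump_conv x) / ?h n" for n
  proof -
    have "x - y + ?h n = x + ?h n - y" for y by simp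
    then show ?thesis
      by (simp only: integral_divide_zero jump_conv_def Bochner_Integration.integral_diff integrable_W_shift)
  qed
  ultimately show ?thesis by simp
qed

text \<open>Once differentiability is known, a single sequence of positive increments identifies the
  derivative.\<close>

lemma jump_conv_derivative:
  assumes "(jump_conv has_real_derivative d) (at x)"
  shows "d = (LINT y|\<nu>. W' (x - y))"
proof -
  have "filterlim (\<lambda>n. inverse (real (Suc n))) (at 0) sequentially"
    using LIMSEQ_inverse_real_of_nat by (auto simp: filterlim_at)
  then have "(\<lambda>n. (jump_conv (x + inverse (real (Suc n))) - jump_conv x) / inverse (real (Suc n)))
      \<longlonglongrightarrow> d"
    using assms unfolding DERIV_def by (rule filterlim_compose[rotated])
  then show ?thesis using jump_conv_difference_quotient by (rule LIMSEQ_unique)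
qed

text \<open>The third derivative of \<open>W\<close> makes \<open>W''\<close> differentiable, hence
  also \<open>jump_conv\<close>, which is a combination of \<open>W\<close>, \<open>W'\<close> and
  \<open>W''\<close>. Equating the two expressions for its derivative gives the generator
  equation.\<close>

lemma generator_right_deriv:
  assumes C3: "C_k_on 3 W {0<..}" and x: "0 < x"
  shows "set_integrable \<nu> {0<..} (generator_integrand (right_deriv W) x)"
    and "generator \<gamma> \<sigma> \<nu> (right_deriv W) x = q * right_deriv W x"
proof -
  have open_pos: "eventually (\<lambda>y. 0 < y) (nhds z)" if "0 < z" for z :: real
    using that eventually_nhds_in_open[of "{0<..}" z] by simp
  have dW: "deriv W z = W' z" if "0 < z" for z
    using W_has_derivative[OF that] by (rule DERIV_imp_deriv)
  have dW': "deriv W' z = W'' z" if "0 < z" for z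
    using W'_has_derivative[OF that] by (rule DERIV_imp_deriv)
  have ddW: "deriv (deriv W) z = W'' z" if "0 < z" for z
    using deriv_cong_ev[OF eventually_mono[OF open_pos[OF that] dW]] dW'[OF that] by simp
  have "(deriv ^^ 2) W field_differentiable at x"
    using C3 x by (auto simp: C_k_on_def)
  then have "(deriv (deriv W) has_real_derivative deriv (deriv (deriv W)) x) (at x)"
    by (simp add: numeral_2_eq_2 field_differentiable_derivI)
  then obtain d where "(deriv (deriv W) has_real_derivative d) (at x)" ..
  then have d: "(W'' has_real_derivative d) (at x)"
    by (rule has_field_derivative_transform_within[of _ _ _ _ x])
      (use x ddW in \<open>auto simp: dist_real_def\<close>)
  have ddW': "deriv (deriv W') x = d"
    using deriv_cong_ev[OF eventually_mono[OF open_pos[OF x] dW']] DERIV_imp_deriv[OF d] by simp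
  have "jump_conv z = (rate + q) * W z - drift * W' z - \<sigma>\<^sup>2 / 2 * W'' z" for z
  proof -
    have "\<sigma>\<^sup>2 / 2 * W'' z = (rate + q) * W z - drift * W' z - jump_conv z"
      unfolding W''_def using sigma_pos by (subst mult.assoc[symmetric]) simp
    then show ?thesis by linarith
  qed
  then have "jump_conv = (\<lambda>z. (rate + q) * W z - drift * W' z - \<sigma>\<^sup>2 / 2 * W'' z)" ..
  moreover have "((\<lambda>z. (rate + q) * W z - drift * W' z - \<sigma>\<^sup>2 / 2 * W'' z) has_real_derivative
      (rate + q) * W' x - drift * W'' x - \<sigma>\<^sup>2 / 2 * d) (at x)"
    by (intro DERIV_diff DERIV_cmult W_has_derivative W'_has_derivative x d)
  ultimately have conv: "(rate + q) * W' x - drift * W'' x - \<sigma>\<^sup>2 / 2 * d = (LINT y|\<nu>. W' (x - y))"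
    by (intro jump_conv_derivative) simp
  have int: "integrable \<nu> (\<lambda>y. W'' x * y * indicator {0<..<1} y)"
    using integrable_mult_right[OF integrable_truncated_id, of "W'' x"] by (simp add: mult.assoc)
  have gi: "generator_integrand W' x = (\<lambda>y. W' (x - y) - W' x + W'' x * y * indicator {0<..<1} y)"
    using dW'[OF x] by (simp add: generator_integrand_def fun_eq_iff)
  have "integrable \<nu> (generator_integrand W' x)"
    unfolding gi using int integrable_W'_shift
    by (intro Bochner_Integration.integrable_add Bochner_Integration.integrable_diff) auto
  note si = set_integral_pos[OF this]
  show "set_integrable \<nu> {0<..} (generator_integrand (right_deriv W) x)"
    using si(1) by (simp add: right_deriv_W)
  have "(LINT y:{0<..}|\<nu>. generator_integrand W' x y)
      = (LINT y|\<nu>. W' (x - y)) - W' x * rate + (LINT y|\<nu>. W'' x * y * indicator {0<..<1} y)"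
    unfolding si(2) unfolding gi using int integrable_W'_shift by (simp add: rate_def mult.commute)
  also have "(LINT y|\<nu>. W'' x * y * indicator {0<..<1} y) = W'' x * (drift - \<gamma>)"
    by (simp add: mult.assoc drift_def)
  \<comment> \<open>With \<open>conv\<close> inserted for the convolution integral, all terms in
    \<open>rate\<close>, \<open>drift\<close>, \<gamma> and \<sigma> cancel and
    \<open>q * W' x\<close> remains.\<close>
  finally show "generator \<gamma> \<sigma> \<nu> (right_deriv W) x = q * right_deriv W x"
    unfolding generator_def right_deriv_W dW'[OF x] ddW' conv[symmetric]
    by (simp add: algebra_simps)
qed

end

theorem proposition2p7:
  fixes P :: "real \<Rightarrow> 'a measure" and X :: "real \<Rightarrow> 'a \<Rightarrow> real"
    and \<gamma> \<sigma> q :: real and \<nu> :: "real measure" and W :: "real \<Rightarrow> real"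
  assumes "q \<ge> 0"
    and "spectrally_negative_levy P X \<gamma> \<sigma> \<nu>"
    and "\<sigma> > 0"
    and "emeasure \<nu> {0<..} < \<infinity>"
    and "is_scale_function \<gamma> \<sigma> \<nu> q W"
    and "C_k_on 3 W {0<..}"
  shows "(\<forall>x. W differentiable at_right x) \<and>
         (\<forall>x>0. set_integrable \<nu> {0<..} (generator_integrand (right_deriv W) x) \<and>
                generator \<gamma> \<sigma> \<nu> (right_deriv W) x - q * right_deriv W x = 0)"
proof -
  have sets: "sets \<nu> = sets borel" and null: "emeasure \<nu> {..0} = 0"
    using assms(2) by (auto simp: spectrally_negative_levy_def levy_triplet_def)
  have "emeasure \<nu> (space \<nu>) = emeasure \<nu> ({..0} \<union> {0<..})"
    using sets_eq_imp_space_eq[OF sets] by (intro arg_cong[where f = "emeasure \<nu>"]) auto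
  also have "\<dots> = emeasure \<nu> {..0} + emeasure \<nu> {0<..}"
    by (subst plus_emeasure) (auto simp: sets)
  finally have "finite_measure \<nu>"
    using null assms(4) by (intro finite_measureI) auto
  then interpret finite_jump_scale_function \<nu> \<gamma> \<sigma> q W
    using assms sets null AE_pos_if_null_nonpos
    by (simp add: finite_jump_scale_function_def finite_jump_scale_function_axioms_def)
  \<comment> \<open>The differentiability and integrability claims ensure that
    \<open>right_deriv\<close> and the integral in \<open>generator\<close> are genuine and not
    default values.\<close>
  show ?thesis
    using W_has_derivative_at_right generator_right_deriv[OF assms(6)]
    by (auto simp: real_differentiable_def)
qed

end
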